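(* There exists a constant $c$ such that for all integers $a\ge 2$ and $l\ge 1$, $$1+\frac{1}{al}\le R(a,l)\le 1+\frac{c}{al}.$$
   Context: For a nonempty finite string $x$ and a rational $r>1$ with $r|x|$ an integer, the fractional power $x^r$ is the prefix of length $r|x|$ of the infinite word $xxx\cdots$. For integers $a\ge 2$, $l\ge 1$, $R(a,l)$ is the infimum of the reals $r>1$ such that there exists an infinite sequence over an $a$-letter alphabet containing no factor (contiguous substring) of the form $x^{r'}$ with $|x|\ge l$ and $r'\ge r$. *)

theory Defs
  imports Complex_Main "HOL-Library.Omega_Words_Fun"
begin

text \<open>
  Only meaningful when \<open>x\<close> is nonempty, \<open>r > 1\<close> and \<open>r * length x\<close> is an integer;
  under the last condition the floor is exact.
\<close>

definition frac_power :: "'a list \<Rightarrow> rat \<Rightarrow> 'a list" where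
  "frac_power x r = prefix (nat \<lfloor>r * of_nat (length x)\<rfloor>) (x\<^sup>\<omega>)"

definition is_factor :: "'a list \<Rightarrow> 'a word \<Rightarrow> bool" where
  "is_factor u w \<longleftrightarrow> (\<exists>i j. i \<le> j \<and> u = w [i \<rightarrow> j])"

text \<open>
  The threshold \<open>r\<close> is real, whereas the exponents \<open>r'\<close> of fractional powers are rational.
\<close>

definition avoids_powers :: "real \<Rightarrow> nat \<Rightarrow> 'a word \<Rightarrow> bool" where
  "avoids_powers r l w \<longleftrightarrow>
     \<not> (\<exists>(x :: 'a list) (r' :: rat).
          x \<noteq> [] \<and> r' > 1 \<and> r' * of_nat (length x) \<in> \<int> \<and>
          length x \<ge> l \<and> of_rat r' \<ge> r \<and>
          is_factor (frac_power x r') w)"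

definition R :: "nat \<Rightarrow> nat \<Rightarrow> real" where
  "R a l = Inf {r. r > 1 \<and> (\<exists>w :: nat word. range w \<subseteq> {..<a} \<and> avoids_powers r l w)}"

end

theory Submission
  imports Defs "HOL-Computational_Algebra.Primes"
begin

text \<open>
  Lower bound: among the positions \<open>0, l, 2 * l, \<dots>, a * l\<close> two carry the same letter.

  Upper bound: one needs an infinite word in which equal factors of length \<open>m\<close> at distance
  \<open>d \<ge> l\<close> satisfy \<open>m = O(d / (a * l))\<close>. With six letters and \<open>O(d / l)\<close> a Toeplitz-like word
  works: a position whose 2-adic valuation is \<open>j\<close> shows the parity of \<open>j\<close> and, modulo 3, the index
  of the block of length \<open>l * 2 ^ j\<close> containing it. If \<open>l * 2 ^ j \<le> d < l * 2 ^ (j + 1)\<close>, then every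
  window of length \<open>2 ^ (j + 2)\<close> contains a position where the shift by \<open>d\<close> is detected: by the
  parities if \<open>2 ^ (j + 1)\<close> does not divide \<open>d\<close>, by the block indices otherwise.
  For large \<open>a\<close> each letter additionally shows the index, modulo about \<open>a / 6\<close>, of the block of
  length \<open>l\<close>; for small \<open>a\<close> the six letters are encoded in binary.
\<close>

section \<open>Fractional powers as agreement of a word with its shift\<close>

text \<open>For \<open>d > 0\<close> this makes \<open>d\<close> a period of the factor of length
  \<open>d + m\<close> at \<open>i\<close>, a power of exponent \<open>1 + m / d\<close>;
  \<open>m\<close> may exceed \<open>d\<close>.\<close>

definition agree_at_shift :: "'a word \<Rightarrow> nat \<Rightarrow> nat \<Rightarrow> nat \<Rightarrow> bool" where
  "agree_at_shift w d i m \<longleftrightarrow> (\<forall>k<m. w (i + k) = w (i + k + d))"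

lemma agree_at_shiftD:
  "agree_at_shift w d i m \<Longrightarrow> i \<le> n \<Longrightarrow> n < i + m \<Longrightarrow> w n = w (n + d)"
  unfolding agree_at_shift_def by (drule spec[of _ "n - i"]) auto

lemma prefix_frac_power_factor:
  assumes "is_factor (frac_power x r) w" "x \<noteq> []"
    and "r * of_nat (length x) = of_nat (length x + m)"
  obtains i where "agree_at_shift w (length x) i m"
proof -
  let ?d = "length x"
  from assms(1) obtain i j where ij: "i \<le> j"
    "prefix (nat \<lfloor>r * of_nat ?d\<rfloor>) (x\<^sup>\<omega>) = w [i \<rightarrow> j]"
    by (auto simp: is_factor_def frac_power_def)
  have "nat \<lfloor>r * of_nat ?d\<rfloor> = ?d + m"
    unfolding assms(3) by (simp only: floor_of_nat nat_int)
  with ij(2) have eq: "prefix (?d + m) (x\<^sup>\<omega>) = w [i \<rightarrow> j]" by simp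
  then have len: "?d + m = j - i" by (metis subsequence_length diff_zero)
  have nth: "w (i + k) = x ! (k mod ?d)" if "k < ?d + m" for k
  proof -
    have "prefix (?d + m) (x\<^sup>\<omega>) ! k = w [i \<rightarrow> j] ! k" using eq by simp
    with that len assms(2) show ?thesis by (simp add: subsequence_def iter_def)
  qed
  have "agree_at_shift w ?d i m"
    unfolding agree_at_shift_def
  proof (intro allI impI)
    fix k assume "k < m"
    then show "w (i + k) = w (i + k + ?d)"
      using nth[of k] nth[of "k + ?d"] by (simp add: add.assoc)
  qed
  then show ?thesis by (rule that)
qed

text \<open>A power of period \<open>d\<close> and length \<open>d + m\<close> has exponent
  \<open>1 + m / d\<close>, which reaches \<open>1 + \<epsilon>\<close> only if
  \<open>m \<ge> \<epsilon> * d\<close>. Rational exponents are thus traded for natural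
  numbers.\<close>

lemma avoids_powers_of_agree_bound:
  fixes w :: "'a word" and \<epsilon> :: real
  assumes "\<And>d i m. d \<ge> l \<Longrightarrow> agree_at_shift w d i m \<Longrightarrow> real m < \<epsilon> * real d"
  shows "avoids_powers (1 + \<epsilon>) l w"
  unfolding avoids_powers_def
proof (intro notI, elim exE conjE)
  fix x :: "'a list" and r' :: rat
  assume x: "x \<noteq> []" "r' > 1" "r' * of_nat (length x) \<in> \<int>" "length x \<ge> l"
    "1 + \<epsilon> \<le> of_rat r'" "is_factor (frac_power x r') w"
  let ?d = "length x"
  from x(3) obtain z where z: "r' * of_nat ?d = of_int z" by (elim Ints_cases)
  have "rat_of_nat ?d < r' * of_nat ?d" using x(1,2) by simp
  then have "int ?d < z" unfolding z by (metis of_int_less_iff of_int_of_nat_eq)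
  moreover define m where "m = nat (z - int ?d)"
  ultimately have m: "z = int (?d + m)" by simp
  have r'm: "r' * of_nat ?d = of_nat (?d + m)" unfolding z m by simp
  obtain i where "agree_at_shift w ?d i m"
    using prefix_frac_power_factor[OF x(6,1) r'm] .
  then have "real m < \<epsilon> * real ?d" using assms x(4) by blast
  moreover have "of_rat r' * real ?d = real (?d + m)"
    using arg_cong[OF r'm, of real_of_rat] by (simp only: of_rat_mult of_rat_of_nat_eq)
  moreover have "(1 + \<epsilon>) * real ?d \<le> of_rat r' * real ?d"
    using x(5) by (intro mult_right_mono) auto
  ultimately show False by (simp add: algebra_simps)
qed

section \<open>Lower bound by the pigeonhole principle\<close>

text \<open>One recurring letter prolongs a period by one position; this smallest repetition is all
  that the lower bound needs.\<close>

lemma is_factor_frac_power_subsequence: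
  fixes w :: "'a word"
  assumes "d > 0" and "w (i + d) = w i"
  shows "is_factor (frac_power (w [i \<rightarrow> i + d]) (1 + 1 / of_nat d)) w"
proof -
  have "(1 + 1 / of_nat d) * rat_of_nat d = of_nat (d + 1)"
    using assms(1) by (simp add: field_simps)
  then have "nat \<lfloor>(1 + 1 / of_nat d) * rat_of_nat (length (w [i \<rightarrow> i + d]))\<rfloor> = d + 1"
    by (metis add_diff_cancel_left' floor_of_nat nat_int subsequence_length)
  then have "frac_power (w [i \<rightarrow> i + d]) (1 + 1 / of_nat d) = prefix (d + 1) ((w [i \<rightarrow> i + d])\<^sup>\<omega>)"
    by (simp only: frac_power_def)
  also have "\<dots> = w [i \<rightarrow> i + d + 1]"
  proof (rule nth_equalityI)
    fix k assume k: "k < length (prefix (d + 1) ((w [i \<rightarrow> i + d])\<^sup>\<omega>))"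
    then have "k < d \<or> k = d" by auto
    then show "prefix (d + 1) ((w [i \<rightarrow> i + d])\<^sup>\<omega>) ! k = w [i \<rightarrow> i + d + 1] ! k"
      using assms k by (auto simp: subsequence_def iter_def nth_append simp del: upt_Suc)
  qed simp
  finally show ?thesis
    unfolding is_factor_def by (intro exI[of _ i] exI[of _ "i + d + 1"]) simp
qed

lemma avoids_powers_lower_bound:
  fixes w :: "nat word"
  assumes a: "a > 0" and l: "l > 0" and w: "range w \<subseteq> {..<a}" and av: "avoids_powers r l w"
  shows "1 + 1 / (real a * real l) \<le> r"
proof (rule ccontr)
  assume less: "\<not> ?thesis"
  have "\<not> inj_on (\<lambda>i. w (i * l)) {..a}"
  proof
    assume "inj_on (\<lambda>i. w (i * l)) {..a}"
    then have "card {..a} \<le> card {..<a}"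
      by (rule card_inj_on_le) (use w in auto)
    then show False by simp
  qed
  then obtain i j where ij: "i < j" "j \<le> a" "w (i * l) = w (j * l)"
    unfolding inj_on_def by (metis atMost_iff linorder_neqE_nat)
  define d where "d = (j - i) * l"
  have "1 * l \<le> d" "d \<le> a * l" unfolding d_def using ij by (intro mult_right_mono; simp)+
  moreover have "i * l + d = j * l" using ij(1) by (simp add: d_def flip: add_mult_distrib)
  ultimately have d: "d > 0" "d \<ge> l" "d \<le> a * l" "i * l + d = j * l" using l by auto
  let ?x = "w [i * l \<rightarrow> i * l + d]" and ?r = "1 + 1 / rat_of_nat d"
  have "is_factor (frac_power ?x ?r) w"
    using d ij by (intro is_factor_frac_power_subsequence) auto
  moreover have "?r * of_nat (length ?x) = of_nat (d + 1)"
    using d(1) by (simp add: field_simps)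
  then have "?r * of_nat (length ?x) \<in> \<int>" by (metis Ints_of_nat)
  \<comment> \<open>Since \<open>d \<le> a * l\<close>, the exponent \<open>1 + 1 / d\<close> is at
    least \<open>1 + 1 / (a * l)\<close>, hence above \<open>r\<close>.\<close>
  moreover have "1 / (real a * real l) \<le> 1 / real d"
    using a l d(1,3) by (intro divide_left_mono) (simp_all flip: of_nat_mult)
  then have "r \<le> of_rat ?r"
    using less by (simp add: of_rat_add of_rat_divide)
  moreover have "?x \<noteq> []" "l \<le> length ?x" "?r > 1"
    using d(1,2) by (auto simp: subsequence_def)
  ultimately show False using av unfolding avoids_powers_def by blast
qed

section \<open>The Toeplitz-like word over six letters\<close>

text \<open>Positions are shifted by one because the valuation of 0 is a junk value.\<close>

definition toeplitz :: "nat \<Rightarrow> nat word" where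
  "toeplitz l n = (let j = multiplicity 2 (Suc n)
     in 3 * (j mod 2) + (Suc n div (l * 2 ^ j)) mod 3)"

lemma toeplitz_less: "toeplitz l n < 6"
proof -
  have "3 * (j mod 2) + b mod 3 < 6" for j b :: nat by presburger
  then show ?thesis by (simp add: toeplitz_def Let_def)
qed

lemma toeplitz_eqD:
  assumes "toeplitz l n = toeplitz l n'"
    and "multiplicity 2 (Suc n) = j" and "multiplicity 2 (Suc n') = j'"
  shows "j mod 2 = j' mod 2" and "(Suc n div (l * 2 ^ j)) mod 3 = (Suc n' div (l * 2 ^ j')) mod 3"
proof -
  have "3 * (j mod 2) + (Suc n div (l * 2 ^ j)) mod 3 =
      3 * (j' mod 2) + (Suc n' div (l * 2 ^ j')) mod 3" (is "3 * ?p + ?q mod 3 = 3 * ?p' + ?q' mod 3")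
    using assms by (simp add: toeplitz_def Let_def)
  moreover have "x = x' \<and> y = y'" if "3 * x + y = 3 * x' + y'" "y < 3" "y' < 3" for x y x' y' :: nat
    using that by presburger
  ultimately show "?p = ?p'" "?q mod 3 = ?q' mod 3" by (metis mod_less_divisor zero_less_numeral)+
qed

lemma ex_mod_eq_in_window:
  fixes i r M :: nat
  assumes "r < M"
  obtains n where "i \<le> n" "n < i + M" "n mod M = r"
proof -
  define n where "n = i + (r + (M - i mod M)) mod M"
  have "n mod M = (i mod M + (r + (M - i mod M))) mod M"
    unfolding n_def by (simp add: mod_simps)
  also have "i mod M + (r + (M - i mod M)) = r + M"
    using mod_less_divisor[of M i] assms by linarith
  finally have "n mod M = r" using assms by simp
  moreover have "i \<le> n" "n < i + M" using assms by (auto simp: n_def)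
  ultimately show ?thesis using that by blast
qed

text \<open>Lets a position of valuation \<open>j\<close> be found in any window of length
  \<open>2 ^ Suc j\<close>, by prescribing its residue.\<close>

lemma multiplicity_2_eq:
  fixes n j :: nat
  assumes "n mod (2 ^ Suc j) = 2 ^ j"
  shows "multiplicity 2 n = j"
proof (rule multiplicity_eqI)
  show "2 ^ j dvd n"
    using dvd_mod_iff[of "2 ^ j" "2 ^ Suc j" n] assms by (simp add: le_imp_power_dvd)
  show "\<not> 2 ^ Suc j dvd n"
    using assms by (simp add: dvd_eq_mod_eq_0)
qed

text \<open>The two remainders add up to less than \<open>2 * L\<close>, so the carry is 0 or
  1.\<close>

lemma div_shift_bounds:
  fixes n d L :: nat
  assumes "L > 0"
  shows "n div L + d div L \<le> (n + d) div L" and "(n + d) div L \<le> n div L + d div L + 1"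
proof -
  have "n mod L + d mod L < 2 * L"
    using mod_less_divisor[OF assms, of n] mod_less_divisor[OF assms, of d] by linarith
  then have "(n mod L + d mod L) div L \<le> 1"
    using less_mult_imp_div_less[of "n mod L + d mod L" 2 L] by simp
  then show "n div L + d div L \<le> (n + d) div L" "(n + d) div L \<le> n div L + d div L + 1"
    by (auto simp: div_add1_eq[of n d])
qed

lemma toeplitz_agree_less:
  assumes l: "l > 0" and d: "l * 2 ^ j \<le> d" "d < l * 2 ^ Suc j"
    and agree: "agree_at_shift (toeplitz l) d i m"
  shows "m < 2 ^ (j + 2)"
proof (rule ccontr)
  assume "\<not> ?thesis"
  then have m: "2 ^ (j + 2) \<le> m" by simp
  have "d > 0" using d(1) l by (cases d) auto
  define t where "t = multiplicity 2 d"
  have agreeS: "toeplitz l n = toeplitz l (n + d)" if "Suc i \<le> Suc n" "Suc n < Suc i + 2 ^ (j + 2)" for n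
    using agree_at_shiftD[OF agree, of n] that m by simp
  show False
  proof (cases "t \<le> j")
    case True
    have t: "2 ^ t dvd d" "\<not> 2 ^ Suc t dvd d"
      using \<open>d > 0\<close> power_dvd_iff_le_multiplicity[of d 2 "Suc t"]
      by (simp_all add: t_def multiplicity_dvd del: power_Suc)
    \<comment> \<open>The shifted position \<open>N\<close> is chosen first, with valuation
      \<open>t + 1\<close>. As \<open>d\<close> has valuation \<open>t\<close>, so has
      \<open>N - d\<close>, and the two parities differ.\<close>
    obtain N where N: "Suc i + d \<le> N" "N < Suc i + d + 2 ^ Suc (Suc t)"
      "N mod 2 ^ Suc (Suc t) = 2 ^ Suc t"
      using ex_mod_eq_in_window[of "2 ^ Suc t" "2 ^ Suc (Suc t)" "Suc i + d"] by auto
    define n where "n = N - d - 1"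
    have n: "N = Suc n + d" using N(1) by (simp add: n_def)
    have "(2::nat) ^ Suc (Suc t) \<le> 2 ^ (j + 2)" using True by (intro power_increasing) auto
    with N(1,2) have eq: "toeplitz l n = toeplitz l (n + d)"
      unfolding n by (intro agreeS) linarith+
    have val': "multiplicity 2 (Suc (n + d)) = Suc t"
      using multiplicity_2_eq[OF N(3)] by (simp add: n)
    then have dvd: "2 ^ Suc t dvd Suc n + d" using multiplicity_dvd[of 2 "Suc (n + d)"] by simp
    have "multiplicity 2 (Suc n) = t"
    proof (rule multiplicity_eqI)
      show "2 ^ t dvd Suc n"
        using power_le_dvd[OF dvd, of t] t(1) dvd_add_left_iff[of "2 ^ t" d "Suc n"] by simp
      show "\<not> 2 ^ Suc t dvd Suc n"
        using dvd t(2) dvd_add_right_iff by blast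
    qed
    from toeplitz_eqD(1)[OF eq this val'] show False by presburger
  next
    case False
    then have dvd: "2 ^ Suc j dvd d"
      unfolding t_def by (intro multiplicity_dvd') simp
    obtain N where N: "Suc i \<le> N" "N < Suc i + 2 ^ Suc j" "N mod 2 ^ Suc j = 2 ^ j"
      using ex_mod_eq_in_window[of "2 ^ j" "2 ^ Suc j" "Suc i"] by auto
    obtain n where n: "N = Suc n" using N(1) by (cases N) auto
    have "(2::nat) ^ Suc j \<le> 2 ^ (j + 2)" by (intro power_increasing) auto
    with N have eq: "toeplitz l n = toeplitz l (n + d)"
      by (intro agreeS) (auto simp: n)
    \<comment> \<open>The shift preserves the residue modulo \<open>2 ^ Suc j\<close>, so both
      positions have valuation \<open>j\<close> and use the same block length.\<close>
    have "(N + d) mod 2 ^ Suc j = 2 ^ j"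
      using N(3) dvd mod_add_right_eq[of N d "2 ^ Suc j"] by (simp add: dvd_eq_mod_eq_0)
    from multiplicity_2_eq[OF this] multiplicity_2_eq[OF N(3)]
    have val: "multiplicity 2 (Suc n) = j" "multiplicity 2 (Suc (n + d)) = j"
      by (auto simp: n)
    let ?L = "l * 2 ^ j"
    have "?L > 0" using l by simp
    \<comment> \<open>From \<open>?L \<le> d < 2 * ?L\<close> the block index grows by 1 or 2, which
      is never 0 modulo 3.\<close>
    moreover have "d div ?L = 1"
      using d by (intro div_nat_eqI) (auto simp: algebra_simps)
    ultimately have "Suc n div ?L + 1 \<le> Suc (n + d) div ?L" "Suc (n + d) div ?L \<le> Suc n div ?L + 2"
      using div_shift_bounds[of ?L "Suc n" d] by auto
    moreover have "x mod 3 \<noteq> y mod 3" if "x + 1 \<le> y" "y \<le> x + 2" for x y :: nat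
      using that by presburger
    ultimately show False using toeplitz_eqD(2)[OF eq val] by blast
  qed
qed

text \<open>At the dyadic scale \<open>l * 2 ^ j \<le> d < l * 2 ^ (j + 1)\<close>, the window
  length \<open>2 ^ (j + 2)\<close> times \<open>l\<close> is at most \<open>4 * d\<close>.\<close>

lemma toeplitz_agree_bound:
  assumes l: "l > 0" and d: "d \<ge> l" and agree: "agree_at_shift (toeplitz l) d i m"
  shows "m * l < 4 * d"
proof -
  have "d div l > 0" using l d by (simp add: div_greater_zero_iff)
  then obtain j where j: "2 ^ j \<le> d div l" "d div l < 2 ^ (j + 1)"
    using ex_power_ivl1[of 2 "d div l"] by auto
  have lj: "l * 2 ^ j \<le> d"
    using order_trans[OF mult_le_mono2[OF j(1)] times_div_less_eq_dividend] .
  moreover have "d < l * 2 ^ Suc j"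
    using j(2) l by (simp add: div_less_iff_less_mult mult.commute mult.left_commute)
  ultimately have "m < 2 ^ (j + 2)"
    using toeplitz_agree_less l agree by blast
  then have "m * l < 2 ^ (j + 2) * l" using l by simp
  also have "\<dots> = 4 * (l * 2 ^ j)" by (simp add: power_add)
  also have "\<dots> \<le> 4 * d" using lj by simp
  finally show ?thesis .
qed

section \<open>Large alphabets\<close>

text \<open>The block index modulo \<open>K\<close> excludes agreement at distances from
  \<open>l\<close> up to \<open>l * (K - 1)\<close>, so the Toeplitz part only has to deal with
  distances from \<open>l * (K - 1)\<close> on.\<close>

definition many_letter_word :: "nat \<Rightarrow> nat \<Rightarrow> nat word" where
  "many_letter_word K l n = 6 * ((n div l) mod K) + toeplitz (l * (K - 1)) n"

lemma many_letter_word_less: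
  assumes "K > 0"
  shows "many_letter_word K l n < 6 * K"
proof -
  have "(n div l) mod K + 1 \<le> K" using assms by (simp add: Suc_leI)
  then have "6 * ((n div l) mod K) + 6 \<le> 6 * K" by linarith
  with toeplitz_less[of "l * (K - 1)" n] show ?thesis
    unfolding many_letter_word_def by linarith
qed

lemma many_letter_word_agree_bound:
  assumes K: "K \<ge> 2" and l: "l > 0" and d: "d \<ge> l"
    and agree: "agree_at_shift (many_letter_word K l) d i m"
  shows "m * (l * (K - 1)) < 4 * d"
proof (cases "m = 0")
  case True
  then show ?thesis using l d by simp
next
  case False
  have digits: "(n div l) mod K = ((n + d) div l) mod K \<and>
      toeplitz (l * (K - 1)) n = toeplitz (l * (K - 1)) (n + d)"
    if "i \<le> n" "n < i + m" for n
  proof -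
    have "6 * ((n div l) mod K) + toeplitz (l * (K - 1)) n =
        6 * (((n + d) div l) mod K) + toeplitz (l * (K - 1)) (n + d)"
      using agree_at_shiftD[OF agree that] by (simp add: many_letter_word_def)
    moreover have "x = x' \<and> y = y'" if "6 * x + y = 6 * x' + y'" "y < 6" "y' < 6" for x y x' y' :: nat
      using that by presburger
    ultimately show ?thesis using toeplitz_less by blast
  qed
  have "d \<ge> l * (K - 1)"
  proof (rule ccontr)
    assume "\<not> ?thesis"
    \<comment> \<open>Even with a carry, the block index then grows by at least 1 and at most
      \<open>K - 1\<close>, so its residue modulo \<open>K\<close> changes.\<close>
    then have "d div l < K - 1" using l by (simp add: div_less_iff_less_mult mult.commute)
    moreover have "d div l > 0" using l d by (simp add: div_greater_zero_iff)
    ultimately have less: "i div l < (i + d) div l" "(i + d) div l < i div l + K"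
      using div_shift_bounds[OF l, of i d] by linarith+
    have "K dvd (i + d) div l - i div l"
      using digits[of i] False less by (intro mod_eq_dvd_iff_nat[THEN iffD1]) auto
    then have "K \<le> (i + d) div l - i div l" using less(1) by (intro dvd_imp_le) auto
    with less show False by linarith
  qed
  moreover have "agree_at_shift (toeplitz (l * (K - 1))) d i m"
    using digits by (auto simp: agree_at_shift_def)
  ultimately show ?thesis
    using K l by (intro toeplitz_agree_bound) auto
qed

section \<open>Small alphabets: binary coding\<close>

text \<open>The letter \<open>s\<close> is encoded as \<open>1\<^sup>s\<^sup>+\<^sup>10\<^sup>7\<^sup>-\<^sup>s\<close>, so that the factor \<open>01\<close> marks code word boundaries.\<close>

definition binary_word :: "nat word \<Rightarrow> nat word" where
  "binary_word v n = of_bool (n mod 8 \<le> v (n div 8))"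

lemma binary_word_block: "r < 8 \<Longrightarrow> binary_word v (8 * q + r) = of_bool (r \<le> v q)"
  by (simp add: binary_word_def)

text \<open>Nine consecutive positions contain the last letter 0 of a block and the first letter 1
  of the next. Inside a block no 1 follows a 0, so the shifted pair straddles a boundary
  too.\<close>

lemma binary_word_agree_dvd:
  assumes v: "\<And>n. v n < 7" and agree: "agree_at_shift (binary_word v) d i m" and m: "m \<ge> 9"
  shows "8 dvd d"
proof -
  define q where "q = i div 8"
  let ?n = "8 * q + 8"
  have n: "i < ?n" "?n < i + m" using m by (auto simp: q_def)
  have "binary_word v (8 * (q + 1) + 0) = 1" by (subst binary_word_block) auto
  then have one: "binary_word v (?n + d) = 1"
    using agree_at_shiftD[OF agree, of ?n] n by (simp add: algebra_simps)
  have "binary_word v (8 * q + 7) = 0" using v[of q] by (subst binary_word_block) auto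
  then have zero: "binary_word v (8 * q + 7 + d) = 0"
    using agree_at_shiftD[OF agree, of "8 * q + 7"] n by simp
  define p where "p = (?n + d) div 8"
  define r where "r = (?n + d) mod 8"
  have pr: "?n + d = 8 * p + r" "r < 8" unfolding p_def r_def by auto
  have "r = 0"
  proof (rule ccontr)
    assume "r \<noteq> 0"
    then have "8 * q + 7 + d = 8 * p + (r - 1)" "r - 1 < 8" using pr by auto
    with zero have "\<not> r - 1 \<le> v p" by (simp add: binary_word_block)
    moreover have "r \<le> v p" using one pr by (simp add: binary_word_block of_bool_def split: if_splits)
    ultimately show False by simp
  qed
  with pr show ?thesis by presburger
qed

text \<open>Only complete blocks can be decoded: \<open>(i + 7) div 8\<close> is the first block
  starting at or after \<open>i\<close>, and up to 7 positions are lost before it.\<close>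

lemma binary_word_agree_decode:
  assumes v: "\<And>n. v n < 7" and agree: "agree_at_shift (binary_word v) (8 * D) i m"
  shows "agree_at_shift v D ((i + 7) div 8) ((m - 7) div 8)"
  unfolding agree_at_shift_def
proof (intro allI impI)
  fix k assume k: "k < (m - 7) div 8"
  define q where "q = (i + 7) div 8 + k"
  have q: "i \<le> 8 * q" "8 * q + 8 \<le> i + m" using k by (auto simp: q_def)
  have iff: "r \<le> v q \<longleftrightarrow> r \<le> v (q + D)" if "r < 8" for r
  proof -
    have "binary_word v (8 * q + r) = binary_word v (8 * (q + D) + r)"
      using agree_at_shiftD[OF agree, of "8 * q + r"] q that
      by (simp add: add_mult_distrib2 add.assoc add.commute add.left_commute)
    with that show ?thesis by (simp only: binary_word_block of_bool_eq_iff)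
  qed
  \<comment> \<open>Testing the threshold at each of the two letters gives both
    inequalities.\<close>
  have "v q = v (q + D)"
    using iff[of "v q"] iff[of "v (q + D)"] v[of q] v[of "q + D"] by simp
  then show "v ((i + 7) div 8 + k) = v ((i + 7) div 8 + k + D)" by (simp add: q_def)
qed

text \<open>The parameter is \<open>l / 8\<close> rounded up, since \<open>d = 8 * D \<ge> l\<close>
  forces \<open>D\<close> to be at least that. The constant is 32 + 14: the decoded agreement gives
  \<open>64 * 4 * D = 32 * d\<close>, and incomplete blocks cost at most
  \<open>14 * l\<close>.\<close>

lemma binary_toeplitz_agree_bound:
  assumes l: "l > 0" and d: "d \<ge> l"
    and agree: "agree_at_shift (binary_word (toeplitz ((l + 7) div 8))) d i m"
  shows "m * l < 46 * d"
proof (cases "m \<ge> 9")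
  case False
  then have "m * l \<le> 8 * d" using d by (intro mult_mono) auto
  with l d show ?thesis by linarith
next
  case True
  define L where "L = (l + 7) div 8"
  have less: "toeplitz L n < 7" for n using toeplitz_less[of L n] by linarith
  from binary_word_agree_dvd[OF less agree[folded L_def] True]
  obtain D where D: "d = 8 * D" by (elim dvdE)
  define M where "M = (m - 7) div 8"
  have "agree_at_shift (toeplitz L) D ((i + 7) div 8) M"
    unfolding M_def using agree less by (intro binary_word_agree_decode) (auto simp: D L_def)
  moreover have L: "L > 0" "L \<le> D" "l \<le> 8 * L" using l d unfolding L_def D by linarith+
  ultimately have MD: "M * L < 4 * D" by (intro toeplitz_agree_bound)
  have "m \<le> 8 * M + 14" unfolding M_def by linarith
  then have "m * l \<le> (8 * M + 14) * l" by simp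
  also have "\<dots> = 8 * (M * l) + 14 * l" by (simp add: algebra_simps)
  also have "M * l \<le> 8 * (M * L)" using mult_le_mono2[OF L(3), of M] by (simp add: algebra_simps)
  finally have "m * l \<le> 64 * (M * L) + 14 * l" by simp
  with MD d show ?thesis unfolding D by linarith
qed

section \<open>Combining both constructions\<close>

text \<open>From 12 letters on, \<open>K = a div 6\<close> is at least 2 and the constant 17 * 4 =
  68 suffices. Below that, \<open>a \<le> 11\<close> gives 11 * 46 = 506.\<close>

lemma ex_word_agree_bound:
  assumes a: "a \<ge> 2" and l: "l > 0"
  shows "\<exists>w :: nat word. range w \<subseteq> {..<a} \<and>
    (\<forall>d i m. d \<ge> l \<longrightarrow> agree_at_shift w d i m \<longrightarrow> m * (a * l) < 506 * d)"
proof (cases "a \<ge> 12")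
  case True
  define K where "K = a div 6"
  have "a = 6 * K + a mod 6" "a mod 6 < 6" by (simp_all add: K_def)
  with True have bounds: "K \<ge> 2" "6 * K \<le> a" "a \<le> 6 * K + 5" by linarith+
  \<comment> \<open>\<open>6 * K + 5 \<le> 17 * (K - 1)\<close> is equivalent to
    \<open>K \<ge> 2\<close>, with equality at \<open>K = 2\<close>, \<open>a = 17\<close>.\<close>
  then have "a \<le> 17 * (K - 1)" unfolding diff_mult_distrib2 by linarith
  with bounds have K: "K \<ge> 2" "6 * K \<le> a" "a \<le> 17 * (K - 1)" by blast+
  have "m * (a * l) < 506 * d" if "d \<ge> l" "agree_at_shift (many_letter_word K l) d i m" for d i m
  proof -
    have "m * (a * l) \<le> m * (17 * (K - 1) * l)" using K(3) by (intro mult_mono) auto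
    also have "\<dots> = 17 * (m * (l * (K - 1)))" by (simp add: algebra_simps)
    also have "m * (l * (K - 1)) < 4 * d"
      using many_letter_word_agree_bound K(1) l that by blast
    finally show ?thesis by simp
  qed
  moreover have "range (many_letter_word K l) \<subseteq> {..<a}"
    using many_letter_word_less[of K l] K by (auto intro: less_le_trans)
  ultimately show ?thesis by blast
next
  case False
  let ?w = "binary_word (toeplitz ((l + 7) div 8))"
  have "m * (a * l) < 506 * d" if "d \<ge> l" "agree_at_shift ?w d i m" for d i m
  proof -
    have "m * (a * l) = a * (m * l)" by simp
    also have "\<dots> \<le> 11 * (m * l)" using False by (intro mult_right_mono) auto
    also have "m * l < 46 * d" using binary_toeplitz_agree_bound l that by blast
    finally show ?thesis by simp
  qed
  moreover have "range ?w \<subseteq> {..<a}" using a by (auto simp: binary_word_def)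
  ultimately show ?thesis by blast
qed

theorem theorem5:
  shows "\<exists>c :: real. \<forall>a l :: nat. a \<ge> 2 \<and> l \<ge> 1 \<longrightarrow>
           1 + 1 / (real a * real l) \<le> R a l \<and>
           R a l \<le> 1 + c / (real a * real l)"
proof (intro exI[of _ 506] allI impI)
  fix a l :: nat
  assume al: "a \<ge> 2 \<and> l \<ge> 1"
  let ?S = "{r. r > 1 \<and> (\<exists>w :: nat word. range w \<subseteq> {..<a} \<and> avoids_powers r l w)}"
  let ?r = "1 + 506 / (real a * real l)"
  obtain w :: "nat word" where w: "range w \<subseteq> {..<a}"
    and bound: "\<And>d i m. d \<ge> l \<Longrightarrow> agree_at_shift w d i m \<Longrightarrow> m * (a * l) < 506 * d"
    using ex_word_agree_bound[of a l] al by auto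
  have "avoids_powers ?r l w"
  proof (rule avoids_powers_of_agree_bound)
    fix d i m assume "d \<ge> l" "agree_at_shift w d i m"
    from bound[OF this] have "real (m * (a * l)) < real (506 * d)" by (simp only: of_nat_less_iff)
    then show "real m < 506 / (real a * real l) * real d"
      using al by (simp add: field_simps)
  qed
  with w al have mem: "?r \<in> ?S" by auto
  have lower: "1 + 1 / (real a * real l) \<le> r" if "r \<in> ?S" for r
    using that al avoids_powers_lower_bound[of a l] by auto
  \<comment> \<open>The infimum of reals is meaningful only for a nonempty set bounded below:
    \<open>mem\<close> gives the former, \<open>lower\<close> the latter.\<close>
  have "1 + 1 / (real a * real l) \<le> Inf ?S"
    using mem lower by (intro cInf_greatest) blast+
  moreover have "Inf ?S \<le> ?r"
    using mem lower by (intro cInf_lower bdd_belowI)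
  ultimately show "1 + 1 / (real a * real l) \<le> R a l \<and> R a l \<le> ?r"
    by (simp add: R_def)
qed

end
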